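(* The rule Subcommittees via Greedy Budgeting Rule (SGBR) satisfies $\lceil \mathrm{w}(k)\rceil^2$-EJR: for every approval-based election with committee size $k$ and every arrival order of the candidates, the committee $W$ returned by SGBR satisfies $\lceil \mathrm{w}(k)\rceil^2$-EJR, where $\mathrm{w}$ is the inverse function of $x\mapsto x^x$ on $[1,\infty)$, i.e., $\mathrm{w}(k)=x$ if $x^x=k$.
   Context: An approval-based election consists of a finite set $C$ of $m$ candidates, a set $N=\{1,\dots,n\}$ of voters, a committee size $k$ with $1\le k\le m$, and for each voter $i\in N$ a set $A(i)\subseteq C$ of approved candidates. $N(c)=\{i\in N: c\in A(i)\}$. In the online setting the candidates arrive in a sequence $c_1,\dots,c_m$; when $c_t$ arrives, $N(c_t)$ is revealed, and one must decide immediately and irrevocably whether to select $c_t$, without knowing $N(c_{t'})$ for $t'>t$. For a real $\rho\ge 1$ and $\ell\in\{1,\dots,k\}$, a group $S\subseteq N$ is $\rho$-$\ell$-cohesive if $|S|\ge \rho\cdot\ell\cdot n/k$ and $\left|\bigcap_{i\in S}A(i)\right|\ge \ell$. A set $W\subseteq C$ of selected candidates satisfies $\rho$-EJR if for each $\ell\in\{1,\dots,k\}$ and each $\rho$-$\ell$-cohesive group $S$ there is a voter $i\in S$ with $|A(i)\cap W|\ge \ell$. SGBR: let $\alpha=\lceil \mathrm{w}(k)\rceil$. Each voter initially has a budget of one (divisible) coin of each of the types $1,\dots,\alpha$. Coins of type $i$ can be used only for buying candidates approved by at least $n\alpha^i/k$ voters. Each candidate costs $n\alpha/k$. When a candidate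 $c$ arrives, find the largest pair $(i,S)$ with $i\in\{1,\dots,\alpha\}$ and $S\subseteq N(c)$ (first maximizing $i$, then $|S|$) such that (1) $|S|\ge n\alpha^i/k$, and (2) each voter in $S$ has at least $\frac{n\alpha}{k|S|}$ coins of type $i$ left. If no such pair exists, $c$ is rejected. Otherwise $c$ is selected and each voter in $S$ pays $\frac{n\alpha}{k|S|}$ in coins of type $i$. The returned committee $W$ is the set of selected candidates (since the voters have $n\alpha$ coins in total and each candidate costs $n\alpha/k$, it has at most $k$ elements). *)

theory Defs
  imports Complex_Main
begin

section \<open>The inverse of \<open>x \<mapsto> x\<^sup>x\<close> on \<open>[1, \<infinity>)\<close>\<close>

definition w :: "real \<Rightarrow> real" where
  "w = the_inv_into {1..} (\<lambda>x. x powr x)"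

lemma bij_betw_self_powr: "bij_betw (\<lambda>x::real. x powr x) {1..} {1..}"
proof -
  have less: "x powr x < y powr y" if "1 \<le> x" "x < y" for x y :: real
  proof -
    have "x powr x < y powr x"
      using that by (intro powr_less_mono2) auto
    also have "\<dots> < y powr y"
      using that by (intro powr_less_mono) auto
    finally show ?thesis .
  qed
  have "inj_on (\<lambda>x::real. x powr x) {1..}"
  proof (rule inj_onI)
    fix x y :: real
    assume "x \<in> {1..}" "y \<in> {1..}" "x powr x = y powr y"
    then show "x = y"
      using less[of x y] less[of y x] by (cases x y rule: linorder_cases) auto
  qed
  moreover have "x powr x \<in> {1..}" if "x \<in> {1..}" for x :: real
    using that by (auto intro: ge_one_powr_ge_zero)
  moreover have "\<exists>x\<in>{1..}. x powr x = y" if "y \<in> {1..}" for y :: real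
  proof -
    have "y powr 1 \<le> y powr y"
      using that by (intro powr_mono) auto
    then have "\<exists>x\<ge>1. x \<le> y \<and> x powr x = y"
      using that by (intro IVT') (auto intro!: continuous_intros)
    then show ?thesis by auto
  qed
  ultimately show ?thesis
    unfolding bij_betw_def by force
qed

lemma w_props:
  assumes "1 \<le> y"
  shows "1 \<le> w y" and "w y powr w y = y"
proof -
  have inj: "inj_on (\<lambda>x::real. x powr x) {1..}"
    and mem: "y \<in> (\<lambda>x::real. x powr x) ` {1..}"
    using bij_betw_self_powr assms by (auto simp: bij_betw_def)
  show "1 \<le> w y"
    using the_inv_into_into[OF inj mem order_refl] by (simp add: w_def)
  show "w y powr w y = y"
    using f_the_inv_into_f[OF inj mem] by (simp add: w_def)
qed



section \<open>Approval-based elections and \<open>\<rho>\<close>-EJR\<close>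

text \<open>
  An election is given by the number \<open>n\<close> of voters (the voters are \<open>1, \<dots>, n\<close>), the committee
  size \<open>k\<close>, and the approval sets \<open>A\<close>; values \<open>A v\<close> for \<open>v\<close> outside \<open>{1..n}\<close> are irrelevant.
\<close>

definition supporters :: "nat \<Rightarrow> (nat \<Rightarrow> 'c set) \<Rightarrow> 'c \<Rightarrow> nat set" where
  "supporters n A c = {v \<in> {1..n}. c \<in> A v}"

definition cohesive ::
  "nat \<Rightarrow> nat \<Rightarrow> (nat \<Rightarrow> 'c set) \<Rightarrow> real \<Rightarrow> nat \<Rightarrow> nat set \<Rightarrow> bool" where
  "cohesive n k A \<rho> l S \<longleftrightarrow>
     S \<subseteq> {1..n} \<and> real (card S) \<ge> \<rho> * real l * real n / real k \<and> card (\<Inter>v\<in>S. A v) \<ge> l"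

definition EJR :: "nat \<Rightarrow> nat \<Rightarrow> (nat \<Rightarrow> 'c set) \<Rightarrow> real \<Rightarrow> 'c set \<Rightarrow> bool" where
  "EJR n k A \<rho> W \<longleftrightarrow>
     (\<forall>l\<in>{1..k}. \<forall>S. cohesive n k A \<rho> l S \<longrightarrow> (\<exists>v\<in>S. card (A v \<inter> W) \<ge> l))"


section \<open>Subcommittees via Greedy Budgeting Rule\<close>

definition coin_types :: "nat \<Rightarrow> nat" where
  "coin_types k = nat \<lceil>w (real k)\<rceil>"

definition price_share :: "nat \<Rightarrow> nat \<Rightarrow> nat set \<Rightarrow> real" where
  "price_share n k S = real n * real (coin_types k) / (real k * real (card S))"

text \<open>
  A budget \<open>b\<close> maps a voter \<open>v\<close> and a coin type \<open>i\<close> to the amount \<open>b v i\<close> of coins of type \<open>i\<close>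
  that \<open>v\<close> has left. The restriction that type-\<open>i\<close> coins only buy candidates with at least
  \<open>n * \<alpha> ^ i / k\<close> supporters is implied by the size bound on \<open>S\<close>.
\<close>

definition feasible_pair ::
  "nat \<Rightarrow> nat \<Rightarrow> (nat \<Rightarrow> 'c set) \<Rightarrow> (nat \<Rightarrow> nat \<Rightarrow> real) \<Rightarrow> 'c \<Rightarrow> nat \<Rightarrow> nat set \<Rightarrow> bool" where
  "feasible_pair n k A b c i S \<longleftrightarrow>
     i \<in> {1..coin_types k} \<and> S \<subseteq> supporters n A c \<and>
     real (card S) \<ge> real n * real (coin_types k) ^ i / real k \<and>
     (\<forall>v\<in>S. b v i \<ge> price_share n k S)"

definition largest_pair ::
  "nat \<Rightarrow> nat \<Rightarrow> (nat \<Rightarrow> 'c set) \<Rightarrow> (nat \<Rightarrow> nat \<Rightarrow> real) \<Rightarrow> 'c \<Rightarrow> nat \<Rightarrow> nat set \<Rightarrow> bool" where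
  "largest_pair n k A b c i S \<longleftrightarrow>
     feasible_pair n k A b c i S \<and>
     (\<forall>i' S'. feasible_pair n k A b c i' S' \<longrightarrow> i' < i \<or> i' = i \<and> card S' \<le> card S)"

definition pay ::
  "nat \<Rightarrow> nat \<Rightarrow> (nat \<Rightarrow> nat \<Rightarrow> real) \<Rightarrow> nat \<Rightarrow> nat set \<Rightarrow> (nat \<Rightarrow> nat \<Rightarrow> real)" where
  "pay n k b i S = (\<lambda>v j. if v \<in> S \<and> j = i then b v j - price_share n k S else b v j)"

text \<open>
  \<open>sgbr_run n k A b cs W\<close>: processing the arriving candidates \<open>cs\<close> in order, starting with
  budget \<open>b\<close>, selects exactly the candidates in \<open>W\<close>. No tie-breaking is fixed: any largest pair
  may be used.
\<close>

inductive sgbr_run ::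
  "nat \<Rightarrow> nat \<Rightarrow> (nat \<Rightarrow> 'c set) \<Rightarrow> (nat \<Rightarrow> nat \<Rightarrow> real) \<Rightarrow> 'c list \<Rightarrow> 'c set \<Rightarrow> bool"
  for n k A where
  finished: "sgbr_run n k A b [] {}"
| reject: "\<nexists>i S. feasible_pair n k A b c i S \<Longrightarrow> sgbr_run n k A b cs W
    \<Longrightarrow> sgbr_run n k A b (c # cs) W"
| select: "largest_pair n k A b c i S \<Longrightarrow> sgbr_run n k A (pay n k b i S) cs W
    \<Longrightarrow> sgbr_run n k A b (c # cs) (insert c W)"

definition sgbr :: "nat \<Rightarrow> nat \<Rightarrow> (nat \<Rightarrow> 'c set) \<Rightarrow> 'c list \<Rightarrow> 'c set \<Rightarrow> bool" where
  "sgbr n k A cs W \<longleftrightarrow> sgbr_run n k A (\<lambda>v i. 1) cs W"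

lemma largest_pair_exists:
  assumes "feasible_pair n k A b c i S"
  shows "\<exists>i S. largest_pair n k A b c i S"
proof -
  let ?I = "{i. \<exists>S. feasible_pair n k A b c i S}"
  have fin_I: "finite ?I"
    by (rule finite_subset[of _ "{1..coin_types k}"]) (auto simp: feasible_pair_def)
  define j where "j = Max ?I"
  have "j \<in> ?I"
    unfolding j_def using fin_I assms by (intro Max_in) auto
  have j_max: "i' \<le> j" if "feasible_pair n k A b c i' S'" for i' S'
    unfolding j_def using fin_I that by (intro Max_ge) auto
  let ?F = "{T. feasible_pair n k A b c j T}"
  have fin_F: "finite ?F"
    by (rule finite_subset[of _ "Pow {1..n}"]) (auto simp: feasible_pair_def supporters_def)
  moreover have "?F \<noteq> {}"
    using \<open>j \<in> ?I\<close> by auto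
  ultimately have "Max (card ` ?F) \<in> card ` ?F"
    by (intro Max_in) auto
  then obtain T where T: "feasible_pair n k A b c j T" "card T = Max (card ` ?F)"
    by auto
  have "card S' \<le> card T" if "feasible_pair n k A b c j S'" for S'
    using fin_F that unfolding T(2) by (intro Max_ge) auto
  then have "largest_pair n k A b c j T"
    using T(1) j_max unfolding largest_pair_def by (metis le_neq_implies_less)
  then show ?thesis by blast
qed

lemma sgbr_exists: "\<exists>W. sgbr n k A cs W"
proof -
  have "\<exists>W. sgbr_run n k A b cs W" for b
  proof (induction cs arbitrary: b)
    case Nil
    then show ?case by (blast intro: sgbr_run.finished)
  next
    case (Cons c cs)
    then show ?case
      by (metis largest_pair_exists sgbr_run.reject sgbr_run.select)
  qed
  then show ?thesis
    by (simp add: sgbr_def)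
qed

end

theory Submission
  imports Defs
begin

text \<open>
  Let \<open>\<alpha> = \<lceil>w k\<rceil>\<close>, so \<open>k \<le> \<alpha> ^ \<alpha>\<close>, let \<open>S\<close> be an \<open>\<alpha>\<^sup>2\<close>-\<open>l\<close>-cohesive group, and let \<open>j\<close> be least
  with \<open>l \<le> \<alpha> ^ j\<close>. Minimality gives \<open>\<alpha> ^ (j + 1) \<le> \<alpha>\<^sup>2 * l\<close>, so \<open>S\<close> is large enough to buy with
  coins of type \<open>j + 1\<close>, and such a purchase costs any voter at most \<open>1 / \<alpha> ^ j \<le> 1 / l\<close>. A voter
  who approves fewer than \<open>l\<close> selected candidates therefore always has at least \<open>1 / l\<close> coins of
  this type left, which is enough for a purchase by all of \<open>S\<close>. So if every voter in \<open>S\<close> were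
  such a voter, all (at least \<open>l\<close>) commonly approved candidates would be selected, a contradiction.
\<close>

lemma real_coin_types:
  assumes "1 \<le> k"
  shows "real (coin_types k) = real_of_int \<lceil>w (real k)\<rceil>"
  using w_props(1)[of "real k"] assms by (simp add: coin_types_def)

lemma coin_types_ge_1:
  assumes "1 \<le> k"
  shows "1 \<le> coin_types k"
  using w_props(1)[of "real k"] assms unfolding coin_types_def by linarith

lemma le_coin_types_power_self:
  assumes "1 \<le> k"
  shows "k \<le> coin_types k ^ coin_types k"
proof -
  let ?a = "real (coin_types k)"
  have w: "1 \<le> w (real k)" "w (real k) \<le> ?a"
    using w_props(1)[of "real k"] assms by (auto simp: real_coin_types)
  have "real k = w (real k) powr w (real k)"
    using w_props(2)[of "real k"] assms by simp
  also have "\<dots> \<le> ?a powr w (real k)"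
    using w by (intro powr_mono2) auto
  also have "\<dots> \<le> ?a powr ?a"
    using w by (intro powr_mono) auto
  also have "\<dots> = ?a ^ coin_types k"
    using w by (intro powr_realpow) auto
  finally show ?thesis
    by (metis of_nat_le_iff of_nat_power)
qed

text \<open>The price \<open>n * \<alpha> / k\<close> is split equally among at least
  \<open>n * q / k\<close> voters. This bounds both actual payments and the share that a cohesive
  group would pay.\<close>

lemma price_share_le:
  assumes "1 \<le> n" "1 \<le> k" "0 < q"
    and "real n * q / real k \<le> real (card S)"
  shows "price_share n k S \<le> real (coin_types k) / q"
proof -
  have "0 < real n * q / real k"
    using assms by simp
  then have pos: "0 < real (card S)"
    using assms(4) by linarith
  have "real n * q \<le> real k * real (card S)"
    using assms by (simp add: field_simps)
  then have "real (coin_types k) * (real n * q) \<le> real (coin_types k) * (real k * real (card S))"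
    by (rule mult_left_mono) simp
  then show ?thesis
    using assms(2,3) pos by (simp add: price_share_def field_simps)
qed

lemma sgbr_run_subset: "sgbr_run n k A b cs W \<Longrightarrow> W \<subseteq> set cs"
  by (induction rule: sgbr_run.induct) auto

text \<open>
  The budget hypothesis counts future purchases: each candidate still to be selected costs a
  supporter at most \<open>\<alpha> / \<alpha> ^ i\<close> coins of type \<open>i\<close>.
\<close>

lemma sgbr_run_selects_common:
  assumes "sgbr_run n k A b cs W" "distinct cs" "1 \<le> n" "1 \<le> k"
    and "S \<subseteq> {1..n}" "i \<in> {1..coin_types k}"
    and "real n * real (coin_types k) ^ i / real k \<le> real (card S)"
    and "\<And>v. v \<in> S \<Longrightarrow> price_share n k S
           + real (card (A v \<inter> W)) * (real (coin_types k) / real (coin_types k) ^ i) \<le> b v i"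
  shows "(\<Inter>v\<in>S. A v) \<inter> set cs \<subseteq> W"
  using assms
proof (induction rule: sgbr_run.induct)
  case (finished b)
  then show ?case by simp
next
  case (reject b c cs W)
  have IH: "(\<Inter>v\<in>S. A v) \<inter> set cs \<subseteq> W"
    using reject.prems by (intro reject.IH) auto
  have "price_share n k S \<le> b v i" if "v \<in> S" for v
    using reject.prems(7)[OF that]
    by (smt (verit) divide_nonneg_nonneg mult_nonneg_nonneg of_nat_0_le_iff zero_le_power)
  \<comment> \<open>Otherwise \<open>(i, S)\<close> itself would be feasible, contradicting the
    rejection of \<open>c\<close>.\<close>
  then have "\<not> S \<subseteq> supporters n A c"
    using reject.hyps(1) reject.prems(5,6) unfolding feasible_pair_def by blast
  then have "c \<notin> (\<Inter>v\<in>S. A v)"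
    using reject.prems(4) by (auto simp: supporters_def)
  then show ?case
    using IH by auto
next
  case (select b c i' S' cs W)
  let ?q = "real (coin_types k) / real (coin_types k) ^ i"
  have sub: "W \<subseteq> set cs"
    using select.hyps(2) by (rule sgbr_run_subset)
  have feas: "feasible_pair n k A b c i' S'"
    using select.hyps(1) by (simp add: largest_pair_def)
  have "price_share n k S + real (card (A v \<inter> W)) * ?q \<le> pay n k b i' S' v i"
    if v: "v \<in> S" for v
  proof (cases "v \<in> S' \<and> i = i'")
    \<comment> \<open>The payment is at most \<open>?q\<close>. Since arrivals are distinct,
      \<open>c\<close> is not in \<open>W\<close>, so the count of future purchases drops by one and
      frees exactly \<open>?q\<close>.\<close>
    case True
    have "c \<in> A v"
      using True feas by (auto simp: feasible_pair_def supporters_def)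
    moreover have "c \<notin> W" "finite W"
      using sub select.prems(1) by (auto intro: finite_subset)
    ultimately have card: "card (A v \<inter> insert c W) = Suc (card (A v \<inter> W))"
      by simp
    have "price_share n k S' \<le> ?q"
      using feas True select.prems(2,3) coin_types_ge_1[OF select.prems(3)]
      by (intro price_share_le) (auto simp: feasible_pair_def)
    then show ?thesis
      using select.prems(7)[OF v] True unfolding card by (simp add: pay_def algebra_simps add_divide_distrib)
  next
    case False
    have "card (A v \<inter> W) \<le> card (A v \<inter> insert c W)"
      using sub by (intro card_mono) (auto intro: finite_subset)
    then have "real (card (A v \<inter> W)) * ?q \<le> real (card (A v \<inter> insert c W)) * ?q"
      by (intro mult_right_mono) auto
    then show ?thesis
      using select.prems(7)[OF v] False by (auto simp: pay_def)
  qed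
  then have "(\<Inter>v\<in>S. A v) \<inter> set cs \<subseteq> W"
    using select.prems by (intro select.IH) auto
  then show ?case
    by auto
qed

text \<open>Take the least \<open>j\<close> with \<open>l \<le> a ^ j\<close>. The bound
  \<open>j < a\<close> makes \<open>Suc j\<close> an existing coin type.\<close>

lemma exists_suitable_power:
  fixes a k l :: nat
  assumes "1 \<le> a" "1 \<le> l" "k \<le> a ^ a" "a\<^sup>2 * l \<le> k"
  obtains j where "j < a" "l \<le> a ^ j" "a ^ Suc j \<le> a\<^sup>2 * l"
proof -
  define j where "j = (LEAST j. l \<le> a ^ j)"
  \<comment> \<open>The exponent \<open>a\<close> witnesses that the \<open>LEAST\<close> is
    attained, via \<open>l \<le> a\<^sup>2 * l \<le> k \<le> a ^ a\<close>.\<close>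
  have "1 * l \<le> a\<^sup>2 * l"
    using assms(1) by (intro mult_right_mono) auto
  then have "l \<le> a ^ a"
    using assms by linarith
  then have l: "l \<le> a ^ j"
    unfolding j_def by (rule LeastI)
  show thesis
  proof (cases j)
    case 0
    have "a * 1 \<le> a * (a * l)"
      using assms by (intro mult_left_mono) auto
    then show thesis
      using that[of j] l 0 assms(1) by (simp add: power2_eq_square mult.assoc)
  next
    case (Suc j')
    have "\<not> l \<le> a ^ j'"
      using not_less_Least[of j' "\<lambda>j. l \<le> a ^ j"] Suc unfolding j_def by simp
    then have "a\<^sup>2 * a ^ j' < a\<^sup>2 * l"
      using assms(1) by (intro mult_strict_left_mono) auto
    then have less: "a ^ Suc j < a\<^sup>2 * l"
      by (simp add: Suc power2_eq_square mult.assoc)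
    have "j < a"
    proof (rule ccontr)
      assume "\<not> j < a"
      \<comment> \<open>This would give
        \<open>k \<le> a ^ a \<le> a ^ Suc j < a\<^sup>2 * l \<le> k\<close>.\<close>
      then have "a ^ a \<le> a ^ Suc j"
        using assms(1) by (intro power_increasing) auto
      then show False
        using less assms(3,4) by linarith
    qed
    then show thesis
      using that[of j] l less by simp
  qed
qed

theorem theorem5p4:
  fixes C :: "'c set" and n k :: nat and A :: "nat \<Rightarrow> 'c set"
    and cs :: "'c list" and W :: "'c set"
  assumes "finite C"
    and "1 \<le> n"
    and "1 \<le> k" and "k \<le> card C"
    and "\<And>v. v \<in> {1..n} \<Longrightarrow> A v \<subseteq> C"
    and "distinct cs" and "set cs = C"
    and "sgbr n k A cs W"
  shows "EJR n k A ((real_of_int \<lceil>w (real k)\<rceil>)\<^sup>2) W"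
proof -
  define a where "a = coin_types k"
  have a1: "1 \<le> a" and ka: "k \<le> a ^ a" and a_real: "real_of_int \<lceil>w (real k)\<rceil> = real a"
    using assms(3) coin_types_ge_1 le_coin_types_power_self real_coin_types
    by (auto simp: a_def)
  have "\<exists>v\<in>S. l \<le> card (A v \<inter> W)"
    if l: "l \<in> {1..k}" and coh: "cohesive n k A ((real a)\<^sup>2) l S" for l S
  proof (rule ccontr)
    assume "\<not> ?thesis"
    then have few: "card (A v \<inter> W) < l" if "v \<in> S" for v
      using that by auto
    have S: "S \<subseteq> {1..n}" and common: "l \<le> card (\<Inter>v\<in>S. A v)"
      and size: "(real a)\<^sup>2 * real l * real n / real k \<le> real (card S)"
      using coh by (auto simp: cohesive_def)
    \<comment> \<open>A cohesive group has at most \<open>n\<close> members, which forces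
      \<open>a\<^sup>2 * l \<le> k\<close>.\<close>
    have "card S \<le> n"
      using card_mono[OF _ S] by simp
    then have "(real a)\<^sup>2 * real l * real n / real k \<le> real n"
      using size by linarith
    then have "(real a)\<^sup>2 * real l \<le> real k"
      using assms(2,3) by (simp add: field_simps)
    then have "real (a\<^sup>2 * l) \<le> real k"
      by simp
    then have "a\<^sup>2 * l \<le> k"
      by (simp only: of_nat_le_iff)
    then obtain j where j: "j < a" "l \<le> a ^ j" "a ^ Suc j \<le> a\<^sup>2 * l"
      using exists_suitable_power[OF a1 _ ka] l by auto
    have "real (a ^ Suc j) \<le> real (a\<^sup>2 * l)"
      using j(3) by (simp only: of_nat_le_iff)
    then have "real n * real a ^ Suc j / real k \<le> real n * ((real a)\<^sup>2 * real l) / real k"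
      by (intro divide_right_mono mult_left_mono) auto
    then have big: "real n * real a ^ Suc j / real k \<le> real (card S)"
      using size by (simp add: mult_ac)
    have "0 < real n * real a ^ Suc j / real k"
      using assms(2,3) a1 by simp
    then have "S \<noteq> {}"
      using big by auto
    have "real l \<le> real a ^ j"
      using j(2) by (metis of_nat_le_iff of_nat_power)
    then have q: "real a / real a ^ Suc j \<le> 1 / real l"
      using l a1 by (simp add: frac_le)
    have share: "price_share n k S \<le> 1 / real l"
      using price_share_le[OF assms(2,3) _ big] q a1 by (simp add: a_def)
    \<comment> \<open>The initial coin covers at most \<open>l - 1\<close> purchases at
      \<open>1 / l\<close> each, plus the share of \<open>S\<close>, again at most
      \<open>1 / l\<close>.\<close>
    have "price_share n k S + real (card (A v \<inter> W)) * (real a / real a ^ Suc j) \<le> 1"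
      if "v \<in> S" for v
    proof -
      have "real (card (A v \<inter> W)) * (real a / real a ^ Suc j) \<le> (real l - 1) * (1 / real l)"
        using few[OF that] q l by (intro mult_mono) auto
      also have "\<dots> = 1 - 1 / real l"
        using l by (simp add: field_simps)
      finally show ?thesis
        using share by linarith
    qed
    then have "(\<Inter>v\<in>S. A v) \<inter> set cs \<subseteq> W"
      using assms(2,3,6,8) S j(1) big unfolding sgbr_def a_def
      by (intro sgbr_run_selects_common[where i = "Suc j"]) auto
    moreover obtain v where v: "v \<in> S"
      using \<open>S \<noteq> {}\<close> by blast
    moreover have "A v \<subseteq> set cs"
      using v S assms(5,7) by blast
    ultimately have "(\<Inter>v\<in>S. A v) \<subseteq> A v \<inter> W"
      by blast
    moreover have "finite (A v \<inter> W)"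
      using \<open>A v \<subseteq> set cs\<close> by (auto intro: finite_subset)
    ultimately have "card (\<Inter>v\<in>S. A v) \<le> card (A v \<inter> W)"
      by (intro card_mono)
    then show False
      using common few[OF v] by linarith
  qed
  then show ?thesis
    by (auto simp: EJR_def a_real)
qed

end
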